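(* Let $(q_n)_{n\ge 0}$ be any $[0,1]$-valued sequence such that $nq_n\to\lambda\in[0,\infty)$. Then $n-1-h(T_{n,q_n})$ converges in distribution, as $n\to\infty$, to a Poisson random variable with parameter $\lambda$ (the constant $0$ if $\lambda=0$).
   Context: Let $T_\infty=\bigcup_{k\ge 0}\{\overline 0,\overline 1\}^k$ be the complete infinite rooted binary tree: nodes are finite strings over $\{\overline 0,\overline 1\}$, the root is the empty string $\varnothing$, the node $u$ has left child $u\overline 0$ and right child $u\overline 1$, and $|u|$ (the depth of $u$) is the length of $u$. For a set $V\subset T_\infty$ write $uV=\{uv:v\in V\}$. A tree is a connected subset of $T_\infty$; its height is $h(T)=\sup_{u\in T}|u|-\inf_{u\in T}|u|$. For a finite sequence $f=(f(1),\dots,f(n))$ of distinct positive integers, the binary search tree $T\langle f\rangle\subset T_\infty$ is defined inductively: $T\langle f\rangle=\emptyset$ if $n=0$; otherwise $T\langle f\rangle=\{\varnothing\}\cup \overline 0\,T\langle f^-\rangle\cup\overline 1\,T\langle f^+\rangle$, where $f^-$ (resp. $f^+$) is the subsequence of terms $f(i)<f(1)$ (resp. $f(i)>f(1)$), in the same order as in $f$. For $n\ge 0$ and $q\in[0,1]$, the Mallows distribution $\pi_{n,q}$ on the symmetric group $\mathcal S_n$ gives each $\sigma$ probability proportional to $q^{\mathrm{Inv}(\sigma)}$, where $\mathrm{Inv}(\sigma)=|\{i<j:\sigma(i)>\sigma(j)\}|$ (with $0^0=1$, so that $\pi_{n,0}$ is concentrated on the identity). $T_{n,q}$ denotes a random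 tree distributed as $T\langle\sigma\rangle$ with $\sigma\sim\pi_{n,q}$. *)

theory Defs
  imports "HOL-Probability.Probability" "HOL-Combinatorics.Permutations"
begin

text \<open>
  Nodes of the complete infinite binary tree are lists over \<^typ>\<open>bool\<close>: \<^term>\<open>False\<close> is the letter 0
  (left), \<^term>\<open>True\<close> is the letter 1 (right), and the depth of a node is its \<^const>\<open>length\<close>.
\<close>
type_synonym node = "bool list"

text \<open>
  The binary search tree of a sequence of distinct numbers. As the comparisons are strict, filtering
  the tail gives the same subsequences as filtering the whole sequence.
\<close>
function bst :: "nat list \<Rightarrow> node set" where
  "bst [] = {}"
| "bst (x # xs) = {[]} \<union> (#) False ` bst (filter (\<lambda>y. y < x) xs)
                        \<union> (#) True ` bst (filter (\<lambda>y. y > x) xs)"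
  by pat_completeness auto
termination
  by (relation "Wellfounded.measure length") (auto simp: less_Suc_eq_le)

lemma finite_bst: "finite (bst xs)"
  by (induction xs rule: bst.induct) auto

text \<open>
  Meaningful for trees of bounded depth, in particular for finite ones. The height of the empty tree
  is 0, since the supremum over the empty set of natural numbers is 0 and subtraction is truncated.
\<close>
definition tree_height :: "node set \<Rightarrow> nat" where
  "tree_height T = (SUP u\<in>T. length u) - (INF u\<in>T. length u)"

definition inversions :: "nat \<Rightarrow> (nat \<Rightarrow> nat) \<Rightarrow> nat" where
  "inversions n \<sigma> = card {(i, j). 1 \<le> i \<and> i < j \<and> j \<le> n \<and> \<sigma> i > \<sigma> j}"

text \<open>
  The symmetric group on \<open>{1..n}\<close> consists of the functions \<open>\<sigma>\<close> with \<open>\<sigma> permutes {1..n}\<close>, which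
  are the identity outside \<open>{1..n}\<close>. The formula is a probability mass function for every
  \<open>q \<ge> 0\<close>, see \<open>pmf_mallows\<close> below; note that \<open>0 ^ 0 = 1\<close>.
\<close>
definition mallows :: "nat \<Rightarrow> real \<Rightarrow> (nat \<Rightarrow> nat) pmf" where
  "mallows n q = embed_pmf (\<lambda>\<sigma>. if \<sigma> permutes {1..n}
     then q ^ inversions n \<sigma> / (\<Sum>\<tau> | \<tau> permutes {1..n}. q ^ inversions n \<tau>) else 0)"

lemma inversions_id: "inversions n id = 0"
proof -
  have "{(i, j). 1 \<le> i \<and> i < j \<and> j \<le> n \<and> id i > (id j :: nat)} = {}" by auto
  then show ?thesis unfolding inversions_def by (simp only: card.empty)
qed

lemma pmf_mallows:
  assumes "q \<ge> 0"
  shows "pmf (mallows n q) \<sigma> = (if \<sigma> permutes {1..n}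
     then q ^ inversions n \<sigma> / (\<Sum>\<tau> | \<tau> permutes {1..n}. q ^ inversions n \<tau>) else 0)"
  unfolding mallows_def
proof (rule pmf_embed_pmf)
  let ?P = "{\<tau>. \<tau> permutes {1..n}}"
  let ?Z = "\<Sum>\<tau>\<in>?P. q ^ inversions n \<tau>"
  let ?f = "\<lambda>\<sigma>. if \<sigma> permutes {1..n} then q ^ inversions n \<sigma> / ?Z else 0"
  have fin: "finite ?P" by (simp add: finite_permutations)
  have "(\<Sum>\<tau>\<in>{id}. q ^ inversions n \<tau>) \<le> ?Z"
    using fin assms by (intro sum_mono2) (auto simp: permutes_id)
  then have Z: "?Z > 0" by (simp add: inversions_id)
  show nonneg: "?f \<sigma> \<ge> 0" for \<sigma> using assms Z by simp
  have "(\<integral>\<^sup>+\<sigma>. ennreal (?f \<sigma>) \<partial>count_space UNIV) = (\<Sum>\<sigma>\<in>?P. ennreal (?f \<sigma>))"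
    using fin by (intro nn_integral_count_space') auto
  also have "\<dots> = ennreal (\<Sum>\<sigma>\<in>?P. ?f \<sigma>)" by (rule sum_ennreal, rule nonneg)
  also have "(\<Sum>\<sigma>\<in>?P. ?f \<sigma>) = (\<Sum>\<sigma>\<in>?P. q ^ inversions n \<sigma> / ?Z)"
    by (intro sum.cong) auto
  also have "\<dots> = 1" using Z by (simp flip: sum_divide_distrib)
  finally show "(\<integral>\<^sup>+\<sigma>. ennreal (?f \<sigma>) \<partial>count_space UNIV) = 1" by simp
qed

text \<open>The law of the random tree obtained from a Mallows permutation.\<close>
definition mallows_tree :: "nat \<Rightarrow> real \<Rightarrow> node set pmf" where
  "mallows_tree n q = map_pmf (\<lambda>\<sigma>. bst (map \<sigma> [1..<Suc n])) (mallows n q)"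

text \<open>The library's \<^const>\<open>poisson_pmf\<close> is specified for positive rates only.\<close>
definition poisson0_pmf :: "real \<Rightarrow> nat pmf" where
  "poisson0_pmf rate = (if rate = 0 then return_pmf 0 else poisson_pmf rate)"

end

theory Submission
  imports Defs
begin

text \<open>
  When \<open>q\<close> is of order \<open>1 / n\<close>, the number of inversions of a Mallows permutation stays bounded in
  probability, and with high probability the permutation is a product of disjoint transpositions
  of neighbours \<open>i\<close>, \<open>i + 1\<close>. Without these transpositions the search tree is a path of height \<open>n - 1\<close>; each of them moves one node
  off that path, because \<open>i + 1\<close> is inserted first and \<open>i\<close> becomes its left child, a leaf. So
  the deficit \<open>n - 1 - h\<close> counts the transpositions, which are rare and nearly independent: a Poisson
  limit. The only exception is a transposition of the last two entries: its leaf hangs below the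
  end of the path and makes up for the lost level.

  The proof needs no estimate of the exceptional permutations. Point masses that are asymptotically
  at least those of a probability distribution must converge to it, since no mass is left over
  (\<open>tendsto_prob_of_point_masses_ge\<close>). A lower bound for the probability of deficit \<open>k\<close>
  comes from the products of \<open>k\<close> disjoint neighbour transpositions that fix the last entry:
  there are \<open>(n - 1 - k) choose k\<close> of them (\<open>card_sparse_sets\<close>), each has exactly \<open>k\<close> inversions
  (\<open>inversions_swaps\<close>) and deficit \<open>k\<close> (\<open>tree_height_swaps\<close>), and the normalising constant is at
  most \<open>(1 - q) ^ (- n)\<close> (\<open>mallows_normaliser_le\<close>). The resulting bound
  \<open>((n - 1 - k) choose k) * q ^ k * (1 - q) ^ n\<close> tends to the Poisson mass
  \<open>lam ^ k / fact k * exp (- lam)\<close>.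
\<close>

section \<open>The normalising constant of the Mallows distribution\<close>

text \<open>
  The Lehmer code splits the inversions according to their right partner, so that the sum over
  permutations of \<open>q\<close> to the number of inversions embeds into a sum over a product set.
\<close>
definition lehmer :: "(nat \<Rightarrow> nat) \<Rightarrow> nat \<Rightarrow> nat" where
  "lehmer \<sigma> j = card {i\<in>{1..<j}. \<sigma> j < \<sigma> i}"

lemma inversions_eq_sum_lehmer: "inversions n \<sigma> = (\<Sum>j\<in>{1..n}. lehmer \<sigma> j)"
proof -
  have "{(i, j). 1 \<le> i \<and> i < j \<and> j \<le> n \<and> \<sigma> i > \<sigma> j}
      = prod.swap ` (SIGMA j:{1..n}. {i\<in>{1..<j}. \<sigma> j < \<sigma> i})"
    by (auto simp: image_iff)
  then show ?thesis
    by (simp add: inversions_def lehmer_def card_image)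
qed

lemma lehmer_less: "1 \<le> j \<Longrightarrow> lehmer \<sigma> j < j"
proof -
  assume "1 \<le> j"
  have "lehmer \<sigma> j \<le> card {1..<j}"
    unfolding lehmer_def by (intro card_mono) auto
  with \<open>1 \<le> j\<close> show ?thesis by simp
qed

text \<open>
  A permutation is recovered from its code from the last position backwards. Once the values at
  positions after \<open>j\<close> are known, so is the set of values used at positions up to \<open>j\<close>, and the code says
  how many elements of this set exceed the value at \<open>j\<close>.
\<close>
lemma lehmer_inj:
  assumes \<sigma>: "\<sigma> permutes {1..n}" and \<tau>: "\<tau> permutes {1..n}"
    and eq: "\<And>j. j \<in> {1..n} \<Longrightarrow> lehmer \<sigma> j = lehmer \<tau> j"
  shows "\<sigma> = \<tau>"
proof -
  have not_less: "\<not> f j < g j"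
    if f: "f permutes {1..n}" and g: "g permutes {1..n}" and j: "j \<in> {1..n}"
      and later: "\<forall>i\<in>{j<..n}. f i = g i" and codes: "lehmer f j = lehmer g j"
    for f g :: "nat \<Rightarrow> nat" and j
  proof
    assume less: "f j < g j"
    have used: "f ` {1..j} = {1..n} - f ` {j<..n}" if "f permutes {1..n}" for f
    proof -
      have "f ` {1..j} = f ` ({1..n} - {j<..n})" using j by (intro arg_cong[of _ _ "image f"]) auto
      also have "\<dots> = f ` {1..n} - f ` {j<..n}"
        using that by (intro image_set_diff) (auto simp: permutes_inj)
      finally show ?thesis using that by (simp add: permutes_image)
    qed
    have same: "f ` {1..j} = g ` {1..j}"
      unfolding used[OF f] used[OF g] using later by (simp cong: image_cong_simp)
    have code: "lehmer f j = card {v \<in> f ` {1..j}. f j < v}" if "f permutes {1..n}" for f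
    proof -
      have "{v \<in> f ` {1..j}. f j < v} = f ` {i\<in>{1..<j}. f j < f i}"
        by (auto simp: image_iff) (metis atLeastLessThan_iff atLeastAtMost_iff le_neq_implies_less less_irrefl)
      then show ?thesis
        using that by (simp add: lehmer_def card_image inj_on_subset[OF permutes_inj])
    qed
    have "{v \<in> g ` {1..j}. g j < v} \<subset> {v \<in> f ` {1..j}. f j < v}"
      using less j unfolding same by auto
    then have "card {v \<in> g ` {1..j}. g j < v} < card {v \<in> f ` {1..j}. f j < v}"
      by (intro psubset_card_mono) auto
    with codes show False by (simp add: code[OF f] code[OF g])
  qed
  have "j \<in> {1..n} \<longrightarrow> \<sigma> j = \<tau> j" for j
  proof (induction "n - j" arbitrary: j rule: less_induct)
    case less
    show ?case
    proof
      assume j: "j \<in> {1..n}"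
      have "\<forall>i\<in>{j<..n}. \<sigma> i = \<tau> i" using less j by auto
      then show "\<sigma> j = \<tau> j"
        using not_less[OF \<sigma> \<tau> j] not_less[OF \<tau> \<sigma> j] eq[OF j] by force
    qed
  qed
  then show ?thesis
    using \<sigma> \<tau> by (intro ext) (metis permutes_not_in)
qed

text \<open>
  By injectivity of the Lehmer code, the sum is at most the sum over all codes, which is
  the product of the truncated geometric series \<open>1 + q + \<dots> + q ^ (j - 1)\<close>.
\<close>
lemma mallows_normaliser_le:
  fixes q :: real
  assumes "0 \<le> q" "q < 1"
  shows "(\<Sum>\<sigma> | \<sigma> permutes {1..n}. q ^ inversions n \<sigma>) \<le> (1 / (1 - q)) ^ n"
proof -
  let ?P = "{\<sigma>. \<sigma> permutes {1..n}}"
  let ?code = "\<lambda>\<sigma>. restrict (lehmer \<sigma>) {1..n}"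
  let ?w = "\<lambda>c. \<Prod>j\<in>{1..n}. q ^ c j"
  have inj: "inj_on ?code ?P"
    by (intro inj_onI lehmer_inj) (auto dest: fun_cong simp: restrict_def, metis)
  have "(\<Sum>\<sigma>\<in>?P. q ^ inversions n \<sigma>) = (\<Sum>\<sigma>\<in>?P. ?w (?code \<sigma>))"
    by (simp add: inversions_eq_sum_lehmer power_sum)
  also have "\<dots> = (\<Sum>c\<in>?code ` ?P. ?w c)"
    using inj by (simp add: sum.reindex)
  also have "\<dots> \<le> (\<Sum>c\<in>PiE {1..n} (\<lambda>j. {..<j}). ?w c)"
    using assms by (intro sum_mono2) (auto intro!: finite_PiE prod_nonneg lehmer_less)
  also have "\<dots> = (\<Prod>j\<in>{1..n}. \<Sum>c<j. q ^ c)"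
    by (simp add: prod_sum_PiE)
  also have "\<dots> \<le> (\<Prod>j\<in>{1..n}. 1 / (1 - q))"
    using assms
    by (intro prod_mono) (auto intro!: sum_nonneg simp: sum_gp_strict divide_right_mono power_le_one)
  finally show ?thesis by simp
qed

section \<open>Sets without two consecutive elements\<close>

text \<open>
  The element \<open>i\<close> of such a set stands for the transposition of \<open>i\<close> and \<open>i + 1\<close>; these
  transpositions are disjoint exactly if the set has no two consecutive elements.
\<close>
definition sparse_sets :: "nat \<Rightarrow> nat \<Rightarrow> nat set set" where
  "sparse_sets m k = {S. S \<subseteq> {1..m} \<and> card S = k \<and> (\<forall>i\<in>S. Suc i \<notin> S)}"

lemma finite_sparse_sets: "finite (sparse_sets m k)"
  by (rule finite_subset[of _ "Pow {1..m}"]) (auto simp: sparse_sets_def)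

lemma sparse_sets_0: "sparse_sets m 0 = {{}}"
  by (auto simp: sparse_sets_def dest: finite_subset)

text \<open>
  A set that contains the largest admissible element avoids the one before it, so this is the
  recursion of the Fibonacci type that Pascal's rule solves in \<open>card_sparse_sets\<close>.
\<close>
lemma sparse_sets_Suc_Suc:
  "sparse_sets (Suc (Suc m)) (Suc k) =
     sparse_sets (Suc m) (Suc k) \<union> insert (Suc (Suc m)) ` sparse_sets m k"
proof (intro equalityI subsetI)
  fix S assume S: "S \<in> sparse_sets (Suc (Suc m)) (Suc k)"
  then have sub: "S \<subseteq> {1..Suc (Suc m)}" and sparse: "\<forall>i\<in>S. Suc i \<notin> S" and card: "card S = Suc k"
    by (auto simp: sparse_sets_def)
  show "S \<in> sparse_sets (Suc m) (Suc k) \<union> insert (Suc (Suc m)) ` sparse_sets m k"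
  proof (cases "Suc (Suc m) \<in> S")
    case True
    then have "Suc m \<notin> S" using sparse by blast
    have "S - {Suc (Suc m)} \<subseteq> {1..m}"
    proof
      fix x assume "x \<in> S - {Suc (Suc m)}"
      then have "x \<in> {1..Suc (Suc m)}" "x \<noteq> Suc (Suc m)" "x \<noteq> Suc m"
        using sub \<open>Suc m \<notin> S\<close> by auto
      then show "x \<in> {1..m}" by auto
    qed
    then have "S - {Suc (Suc m)} \<in> sparse_sets m k"
      using True sparse card by (auto simp: sparse_sets_def)
    then show ?thesis using True by (auto simp: image_iff intro!: bexI[of _ "S - {Suc (Suc m)}"])
  next
    case False
    with sub have "S \<subseteq> {1..Suc m}" by (auto simp: subset_iff le_Suc_eq)
    then show ?thesis using S by (auto simp: sparse_sets_def)
  qed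
next
  fix S assume "S \<in> sparse_sets (Suc m) (Suc k) \<union> insert (Suc (Suc m)) ` sparse_sets m k"
  then show "S \<in> sparse_sets (Suc (Suc m)) (Suc k)"
  proof
    assume "S \<in> insert (Suc (Suc m)) ` sparse_sets m k"
    then obtain R where R: "R \<subseteq> {1..m}" "card R = k" "\<forall>i\<in>R. Suc i \<notin> R"
        and S: "S = insert (Suc (Suc m)) R"
      by (auto simp: sparse_sets_def)
    have "finite R" "Suc (Suc m) \<notin> R" "Suc m \<notin> R" "Suc (Suc (Suc m)) \<notin> R"
      using R(1) by (auto intro: finite_subset)
    with R show ?thesis unfolding S by (auto simp: sparse_sets_def)
  qed (auto simp: sparse_sets_def subset_iff)
qed

lemma card_sparse_sets: "card (sparse_sets m k) = (Suc m - k) choose k"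
proof (induction m arbitrary: k rule: induct_nat_012)
  case 0
  show ?case
  proof (cases k)
    case (Suc l)
    then have "sparse_sets 0 k = {}" by (auto simp: sparse_sets_def)
    then show ?thesis by (simp add: Suc)
  qed (simp add: sparse_sets_0)
next
  case 1
  show ?case
  proof (cases k)
    case (Suc l)
    have "sparse_sets 1 k = (if l = 0 then {{1}} else {})"
      by (auto simp: sparse_sets_def Suc subset_singleton_iff)
    then show ?thesis by (auto simp: Suc)
  qed (simp add: sparse_sets_0)
next
  case (ge2 m)
  show ?case
  proof (cases k)
    case (Suc l)
    have disj: "sparse_sets (Suc m) (Suc l) \<inter> insert (Suc (Suc m)) ` sparse_sets m l = {}"
      by (auto simp: sparse_sets_def)
    have "inj_on (insert (Suc (Suc m))) (sparse_sets m l)"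
    proof (rule inj_onI)
      fix R R' assume R: "R \<in> sparse_sets m l" "R' \<in> sparse_sets m l"
        and eq: "insert (Suc (Suc m)) R = insert (Suc (Suc m)) R'"
      from R have "Suc (Suc m) \<notin> R" "Suc (Suc m) \<notin> R'"
        by (auto simp: sparse_sets_def)
      with eq show "R = R'" by (simp add: insert_ident)
    qed
    then have "card (sparse_sets (Suc (Suc m)) k) = card (sparse_sets (Suc m) k) + card (sparse_sets m l)"
      using disj by (simp add: Suc sparse_sets_Suc_Suc card_Un_disjoint finite_sparse_sets card_image)
    also have "\<dots> = ((Suc m - l) choose Suc l) + ((Suc m - l) choose l)"
      by (simp add: ge2 Suc)
    also have "\<dots> = (Suc (Suc (Suc m)) - k) choose k"
      by (cases "l \<le> Suc m") (auto simp: Suc Suc_diff_le binomial_eq_0)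
    finally show ?thesis .
  qed (simp add: sparse_sets_0)
qed

section \<open>Products of disjoint adjacent transpositions\<close>

text \<open>
  The product of the transpositions of \<open>i\<close> and \<open>i + 1\<close> for \<open>i \<in> S\<close>, provided that they are
  disjoint and \<open>0 \<notin> S\<close>. The latter makes the truncated subtraction harmless at \<open>0\<close>.
\<close>
definition swaps :: "nat set \<Rightarrow> nat \<Rightarrow> nat" where
  "swaps S i = (if i \<in> S then Suc i else if i - 1 \<in> S then i - 1 else i)"

lemma swaps_inj: "inj_on swaps (sparse_sets m k)"
proof (rule inj_onI)
  have "S = {i. swaps S i = Suc i}" for S
    by (auto simp: swaps_def split: if_splits)
  then show "S = R" if "swaps S = swaps R" for S R using that by metis
qed

context
  fixes S :: "nat set" and m k :: nat
  assumes S: "S \<in> sparse_sets m k"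
begin

lemma swaps_support: "S \<subseteq> {1..m}" "0 \<notin> S" "finite S" "card S = k"
  using S by (auto simp: sparse_sets_def intro: finite_subset)

lemma swaps_sparse: "i \<in> S \<Longrightarrow> Suc i \<notin> S"
  using S by (auto simp: sparse_sets_def)

lemma swaps_swaps: "swaps S (swaps S i) = i"
  using swaps_support(2) swaps_sparse by (cases i) (auto simp: swaps_def)

lemma swaps_permutes: "swaps S permutes {1..Suc m}"
proof -
  have "swaps S i = i" if "i \<notin> {1..Suc m}" for i
    using that swaps_support by (cases i) (auto simp: swaps_def)
  moreover have "\<exists>!i. swaps S i = j" for j
    by (metis swaps_swaps)
  ultimately show ?thesis by (simp add: permutes_def)
qed

text \<open>
  Every value is displaced by at most one, so an inverted pair consists of neighbours that
  have been exchanged.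
\<close>
lemma inversions_swaps:
  assumes "m < n"
  shows "inversions n (swaps S) = k"
proof -
  have "{(i, j). 1 \<le> i \<and> i < j \<and> j \<le> n \<and> swaps S i > swaps S j} = (\<lambda>i. (i, Suc i)) ` S"
  proof (intro equalityI subsetI)
    fix p assume "p \<in> {(i, j). 1 \<le> i \<and> i < j \<and> j \<le> n \<and> swaps S i > swaps S j}"
    then obtain i j where p: "p = (i, j)" and ij: "i < j" "swaps S i > swaps S j" by auto
    have "swaps S i \<le> Suc i" "j - 1 \<le> swaps S j" by (auto simp: swaps_def)
    with ij have "j = Suc i" by linarith
    moreover from this ij(2) have "i \<in> S"
      by (auto simp: swaps_def split: if_splits)
    ultimately show "p \<in> (\<lambda>i. (i, Suc i)) ` S" by (simp add: p)
  next
    fix p assume "p \<in> (\<lambda>i. (i, Suc i)) ` S"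
    then show "p \<in> {(i, j). 1 \<le> i \<and> i < j \<and> j \<le> n \<and> swaps S i > swaps S j}"
      using swaps_support(1) swaps_sparse assms by (fastforce simp: swaps_def)
  qed
  then show ?thesis
    using swaps_support(4) by (simp add: inversions_def card_image inj_on_def)
qed

end

section \<open>Heights of binary search trees\<close>

lemma root_in_bst: "xs \<noteq> [] \<Longrightarrow> [] \<in> bst xs"
  by (cases xs) auto

lemma tree_height_bst:
  assumes "xs \<noteq> []"
  shows "tree_height (bst xs) = Max (length ` bst xs)"
proof -
  have root: "0 \<in> length ` bst xs" using root_in_bst[OF assms] by force
  then have "Inf (length ` bst xs) = 0" by (metis cInf_eq_minimum le0)
  moreover have "Sup (length ` bst xs) = Max (length ` bst xs)"
    using root finite_bst by (intro cSup_eq_Max) auto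
  ultimately show ?thesis by (simp add: tree_height_def)
qed

lemma Max_length_Cons:
  assumes "xs \<noteq> []"
  shows "Max (length ` (#) b ` bst xs) = Suc (Max (length ` bst xs))"
proof -
  have "length ` (#) b ` bst xs = Suc ` length ` bst xs" by (simp add: image_image)
  then show ?thesis
    using root_in_bst[OF assms]
    by (auto simp: finite_bst intro!: mono_Max_commute[OF mono_Suc, symmetric])
qed

lemma tree_height_bst_min:
  assumes "xs \<noteq> []" "\<forall>y\<in>set xs. x < y"
  shows "tree_height (bst (x # xs)) = Suc (tree_height (bst xs))"
proof -
  have "filter (\<lambda>y. y < x) xs = []" "filter (\<lambda>y. y > x) xs = xs"
    using assms by (auto simp: filter_empty_conv filter_id_conv)
  then have "Max (length ` bst (x # xs)) = max 0 (Max (length ` (#) True ` bst xs))"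
    using assms root_in_bst by (subst Max_insert[symmetric]) (auto simp: finite_bst)
  then show ?thesis using assms by (simp add: tree_height_bst Max_length_Cons del: bst.simps)
qed

text \<open>
  The second key becomes a leaf at depth one, which is no deeper than the tree of the remaining
  keys as soon as there are any. Hence the two keys together contribute only one level.
\<close>
lemma tree_height_bst_swap:
  assumes "xs \<noteq> []" "y < x" "\<forall>z\<in>set xs. x < z"
  shows "tree_height (bst (x # y # xs)) = Suc (tree_height (bst xs))"
proof -
  have "filter (\<lambda>z. z < x) xs = []" "filter (\<lambda>z. z > x) xs = xs"
    using assms by (auto simp: filter_empty_conv filter_id_conv)
  then have "bst (x # y # xs) = insert [] (insert [False] ((#) True ` bst xs))"
    using assms(2) by auto
  moreover have "bst xs \<noteq> {}"
    using root_in_bst[OF assms(1)] by auto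
  ultimately have "Max (length ` bst (x # y # xs)) = max 0 (max 1 (Max (length ` (#) True ` bst xs)))"
    by (simp add: finite_bst del: bst.simps)
  then show ?thesis using assms by (simp add: tree_height_bst Max_length_Cons del: bst.simps)
qed

text \<open>
  The tree of a suffix that does not cut through a transposition consumes one key, or the two keys of
  a transposition, per level. The permutation acts on \<open>m + 2\<close> positions while \<open>S\<close> lies in \<open>{1..m}\<close>:
  position \<open>m + 2\<close> stays fixed, so that some key always follows a transposition.
\<close>
lemma tree_height_swaps_suffix:
  assumes S: "S \<in> sparse_sets m k" and "i - 1 \<notin> S" "i \<le> Suc (Suc m)"
  shows "tree_height (bst (map (swaps S) [i..<Suc (Suc (Suc m))])) + card (S \<inter> {i..}) = Suc (Suc m) - i"
  using assms(2,3)
proof (induction "Suc (Suc m) - i" arbitrary: i rule: less_induct)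
  case less
  note supp = swaps_support[OF S] and sparse = swaps_sparse[OF S]
  let ?N = "Suc (Suc (Suc m))"
  let ?L = "\<lambda>i. map (swaps S) [i..<?N]"
  have "i < swaps S x" if "i \<notin> S" "i < x" for i x
    using that by (cases "x - 1 = i") (auto simp: swaps_def)
  then have later: "\<forall>y\<in>set (?L (Suc i)). i < y" if "i \<notin> S" for i
    using that by (auto simp del: upt_Suc)
  show ?case
  proof (cases "i = Suc (Suc m)")
    case True
    then have "S \<inter> {i..} = {}" using supp(1) by auto
    then show ?thesis using True by (simp add: tree_height_def)
  next
    case False
    with less.prems have i: "i < Suc (Suc m)" by simp
    show ?thesis
    proof (cases "i \<in> S")
      case False
      have "?L i = i # ?L (Suc i)"
        using i False less.prems by (subst upt_rec) (auto simp: swaps_def)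
      then have "tree_height (bst (?L i)) = Suc (tree_height (bst (?L (Suc i))))"
        using later[OF False] i by (simp add: tree_height_bst_min del: bst.simps upt_Suc)
      moreover have "S \<inter> {i..} = S \<inter> {Suc i..}"
        using False by (auto simp: Suc_le_eq order_less_le)
      ultimately show ?thesis
        using less.hyps[of "Suc i"] False i by (simp del: upt_Suc)
    next
      case True
      with supp(1) have im: "i \<le> m" by auto
      have "?L i = Suc i # i # ?L (Suc (Suc i))"
        using im True sparse by (subst upt_rec, subst upt_rec) (auto simp: swaps_def simp del: upt_Suc)
      moreover have "\<forall>y\<in>set (?L (Suc (Suc i))). Suc i < y"
        by (rule later[OF sparse[OF True]])
      ultimately have "tree_height (bst (?L i)) = Suc (tree_height (bst (?L (Suc (Suc i)))))"
        using im by (simp add: tree_height_bst_swap del: bst.simps upt_Suc)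
      moreover have "S \<inter> {i..} = insert i (S \<inter> {Suc (Suc i)..})"
        using True sparse[OF True] by (auto simp: Suc_le_eq order_less_le)
      ultimately show ?thesis
        using less.hyps[of "Suc (Suc i)"] sparse[OF True] im supp(3) by (simp del: upt_Suc)
    qed
  qed
qed

lemma tree_height_swaps:
  assumes S: "S \<in> sparse_sets m k"
  shows "tree_height (bst (map (swaps S) [1..<Suc (m + 2)])) + k = m + 1"
proof -
  have "S \<inter> {1..} = S" "0 \<notin> S" using swaps_support[OF S] by auto
  then show ?thesis
    using tree_height_swaps_suffix[OF S, of 1] swaps_support[OF S] by (simp del: upt_Suc)
qed

section \<open>Point masses of the height deficit\<close>

lemma prob_height_deficit_ge:
  assumes q: "0 \<le> q" "q < 1"
  shows "real ((m + 1 - k) choose k) * q ^ k * (1 - q) ^ (m + 2)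
    \<le> measure_pmf.prob (mallows_tree (m + 2) q) {T. real (m + 2) - 1 - real (tree_height T) = real k}"
proof -
  let ?n = "m + 2"
  let ?Z = "\<Sum>\<sigma> | \<sigma> permutes {1..?n}. q ^ inversions ?n \<sigma>"
  let ?F = "swaps ` sparse_sets m k"
  have perm: "\<sigma> permutes {1..?n}" if "\<sigma> \<in> ?F" for \<sigma>
    using that by (auto intro: permutes_subset[OF swaps_permutes])
  have "(\<Sum>\<sigma>\<in>{id}. q ^ inversions ?n \<sigma>) \<le> ?Z"
    using q by (intro sum_mono2) (auto simp: permutes_id finite_permutations)
  then have Z: "0 < ?Z" by (simp add: inversions_id)
  have "?Z \<le> 1 / (1 - q) ^ ?n"
    using mallows_normaliser_le[OF q, of ?n] by (simp add: power_one_over)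
  then have "(1 - q) ^ ?n \<le> 1 / ?Z"
    using Z q pos_le_divide_eq[of "(1 - q) ^ ?n" ?Z 1] pos_le_divide_eq[of ?Z "(1 - q) ^ ?n" 1]
    by (simp only: mult.commute zero_less_power diff_gt_0_iff_gt)
  then have "real (card ?F) * q ^ k * (1 - q) ^ ?n \<le> real (card ?F) * q ^ k * (1 / ?Z)"
    using q by (intro mult_left_mono) auto
  also have "\<dots> = (\<Sum>\<sigma>\<in>?F. q ^ k / ?Z)"
    by simp
  also have "\<dots> = (\<Sum>\<sigma>\<in>?F. pmf (mallows ?n q) \<sigma>)"
    using q perm by (intro sum.cong) (auto simp: pmf_mallows inversions_swaps)
  also have "\<dots> = measure_pmf.prob (mallows ?n q) ?F"
    by (simp add: measure_measure_pmf_finite finite_sparse_sets)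
  also have "\<dots> \<le> measure_pmf.prob (mallows ?n q)
      {\<sigma>. real ?n - 1 - real (tree_height (bst (map \<sigma> [1..<Suc ?n]))) = real k}"
  proof (intro measure_pmf.finite_measure_mono subsetI CollectI)
    fix \<sigma> assume "\<sigma> \<in> ?F"
    then have "tree_height (bst (map \<sigma> [1..<Suc ?n])) + k = m + 1"
      using tree_height_swaps by blast
    then show "real ?n - 1 - real (tree_height (bst (map \<sigma> [1..<Suc ?n]))) = real k"
      by linarith
  qed simp
  finally show ?thesis
    by (simp add: card_image swaps_inj card_sparse_sets mallows_tree_def vimage_def del: upt_Suc)
qed

lemma pmf_poisson0: "0 \<le> r \<Longrightarrow> pmf (poisson0_pmf r) k = r ^ k / fact k * exp (- r)"
  by (cases k) (auto simp: poisson0_pmf_def)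

text \<open>
  For fixed \<open>k\<close> the binomial coefficient is a product of \<open>k\<close> factors \<open>(n - c - i) / (k - i)\<close>, and
  each of them takes up one factor \<open>q n\<close>.
\<close>
lemma tendsto_binomial_power:
  fixes q :: "nat \<Rightarrow> real"
  assumes "(\<lambda>n. real n * q n) \<longlonglongrightarrow> lam" "q \<longlonglongrightarrow> 0"
  shows "(\<lambda>n. real ((n - c) choose k) * q n ^ k) \<longlonglongrightarrow> lam ^ k / fact k"
proof -
  have "(\<lambda>n. \<Prod>i=0..<k. (real n * q n - real (c + i) * q n) / real (k - i))
      \<longlonglongrightarrow> (\<Prod>i=0..<k. (lam - real (c + i) * 0) / real (k - i))"
    by (intro tendsto_prod tendsto_divide tendsto_diff tendsto_mult assms tendsto_const) auto
  also have "(\<Prod>i=0..<k. (lam - real (c + i) * 0) / real (k - i)) = lam ^ k / fact k"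
    by (simp add: prod_dividef fact_prod_rev)
  finally show ?thesis
  proof (rule Lim_transform_eventually)
    show "\<forall>\<^sub>F n in sequentially. (\<Prod>i=0..<k. (real n * q n - real (c + i) * q n) / real (k - i))
        = real ((n - c) choose k) * q n ^ k"
      using eventually_ge_at_top[of "c + k"]
    proof eventually_elim
      case (elim n)
      then have "real ((n - c) choose k) = (\<Prod>i=0..<k. real (n - c - i) / real (k - i))"
        by (intro binomial_altdef_of_nat) simp
      then have "real ((n - c) choose k) * q n ^ k = (\<Prod>i=0..<k. real (n - c - i) / real (k - i) * q n)"
        by (simp only: prod.distrib prod_constant card_atLeastLessThan diff_zero)
      also have "\<dots> = (\<Prod>i=0..<k. (real n * q n - real (c + i) * q n) / real (k - i))"
        using elim by (intro prod.cong) (auto simp: of_nat_diff algebra_simps)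
      finally show ?case by simp
    qed
  qed
qed

lemma tendsto_one_minus_power:
  fixes q :: "nat \<Rightarrow> real"
  assumes lim: "(\<lambda>n. real n * q n) \<longlonglongrightarrow> lam" and q0: "q \<longlonglongrightarrow> 0" and nonneg: "\<And>n. 0 \<le> q n"
  shows "(\<lambda>n. (1 - q n) ^ n) \<longlonglongrightarrow> exp (- lam)"
proof (rule tendsto_sandwich)
  have small: "\<forall>\<^sub>F n in sequentially. q n < 1 / 2"
    by (rule order_tendstoD(2)[OF q0]) simp
  have power: "(1 - q n) ^ n = exp (real n * ln (1 - q n))" if "q n < 1 / 2" for n
    using that by (simp add: exp_of_nat_mult)
  show "\<forall>\<^sub>F n in sequentially. exp (- (real n * q n) - 2 * (real n * q n) * q n) \<le> (1 - q n) ^ n"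
    using small
  proof eventually_elim
    case (elim n)
    have "real n * (- q n - 2 * (q n)\<^sup>2) \<le> real n * ln (1 - q n)"
      using elim nonneg by (intro mult_left_mono ln_one_minus_pos_lower_bound) auto
    then show ?case
      by (simp add: power[OF elim] algebra_simps power2_eq_square)
  qed
  show "\<forall>\<^sub>F n in sequentially. (1 - q n) ^ n \<le> exp (- (real n * q n))"
    using small
  proof eventually_elim
    case (elim n)
    have "real n * ln (1 - q n) \<le> real n * (- q n)"
      using elim ln_add_one_self_le_self2[of "- q n"] by (intro mult_left_mono) auto
    then show ?case by (simp add: power[OF elim])
  qed
  show "(\<lambda>n. exp (- (real n * q n))) \<longlonglongrightarrow> exp (- lam)"
    by (intro tendsto_intros lim)
  have "(\<lambda>n. exp (- (real n * q n) - 2 * (real n * q n) * q n)) \<longlonglongrightarrow> exp (- lam - 2 * lam * 0)"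
    by (intro tendsto_intros lim q0)
  then show "(\<lambda>n. exp (- (real n * q n) - 2 * (real n * q n) * q n)) \<longlonglongrightarrow> exp (- lam)"
    by simp
qed

section \<open>From point masses to weak convergence\<close>

text \<open>
  A discrete form of Scheffe's lemma. Summing the bounds over finite parts of \<open>A\<close> gives
  \<open>liminf P(X n \<in> A) \<ge> Q A\<close>; as both sides are probabilities, the same bound for the complement
  of \<open>A\<close> gives \<open>limsup P(X n \<in> A) \<le> Q A\<close>.
\<close>
lemma tendsto_prob_of_point_masses_ge:
  fixes X :: "nat \<Rightarrow> 'a \<Rightarrow> real" and p :: "nat \<Rightarrow> 'a pmf" and Q :: "nat pmf"
  assumes ge: "\<And>k. \<forall>\<^sub>F n in sequentially. a n k \<le> measure_pmf.prob (p n) {x. X n x = real k}"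
    and lim: "\<And>k. (\<lambda>n. a n k) \<longlonglongrightarrow> pmf Q k"
  shows "(\<lambda>n. measure_pmf.prob (p n) {x. X n x \<in> A}) \<longlonglongrightarrow> measure_pmf.prob Q {k. real k \<in> A}"
proof -
  have lower: "\<forall>\<^sub>F n in sequentially. y < measure_pmf.prob (p n) {x. X n x \<in> A}"
    if y: "y < measure_pmf.prob Q {k. real k \<in> A}" for y A
  proof -
    have "(\<lambda>N. measure_pmf.prob Q ({k. real k \<in> A} \<inter> {..N})) \<longlonglongrightarrow>
        measure_pmf.prob Q (\<Union>N. {k. real k \<in> A} \<inter> {..N})"
      by (intro measure_pmf.finite_Lim_measure_incseq) (auto simp: incseq_def)
    also have "(\<Union>N. {k. real k \<in> A} \<inter> {..N}) = {k. real k \<in> A}" by auto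
    finally have "\<forall>\<^sub>F N in sequentially. y < measure_pmf.prob Q ({k. real k \<in> A} \<inter> {..N})"
      using y by (rule order_tendstoD(1))
    then obtain N where N: "y < measure_pmf.prob Q ({k. real k \<in> A} \<inter> {..N})"
      by (auto simp: eventually_sequentially)
    define F where "F = {k. real k \<in> A} \<inter> {..N}"
    have "(\<lambda>n. \<Sum>k\<in>F. a n k) \<longlonglongrightarrow> (\<Sum>k\<in>F. pmf Q k)"
      by (intro tendsto_sum lim)
    moreover have "y < (\<Sum>k\<in>F. pmf Q k)"
      using N by (simp add: F_def measure_measure_pmf_finite)
    ultimately have "\<forall>\<^sub>F n in sequentially. y < (\<Sum>k\<in>F. a n k)"
      by (rule order_tendstoD(1))
    moreover have "\<forall>\<^sub>F n in sequentially. \<forall>k\<in>F. a n k \<le> measure_pmf.prob (p n) {x. X n x = real k}"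
      using ge by (intro eventually_ball_finite) (auto simp: F_def)
    ultimately show ?thesis
    proof eventually_elim
      case (elim n)
      have "y < (\<Sum>k\<in>F. a n k)" by fact
      also have "\<dots> \<le> (\<Sum>k\<in>F. measure_pmf.prob (p n) {x. X n x = real k})"
        using elim by (intro sum_mono) auto
      also have "\<dots> = measure_pmf.prob (p n) (\<Union>k\<in>F. {x. X n x = real k})"
        by (intro measure_pmf.finite_measure_finite_Union[symmetric])
           (auto simp: F_def disjoint_family_on_def)
      also have "\<dots> \<le> measure_pmf.prob (p n) {x. X n x \<in> A}"
        by (intro measure_pmf.finite_measure_mono) (auto simp: F_def)
      finally show ?case .
    qed
  qed
  show ?thesis
  proof (rule order_tendstoI)
    fix y assume y: "measure_pmf.prob Q {k. real k \<in> A} < y"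
    have compl: "measure_pmf.prob r {x. f x \<in> - A} = 1 - measure_pmf.prob r {x. f x \<in> A}"
      for r :: "'b pmf" and f
      using measure_pmf.prob_compl[of "{x. f x \<in> A}" r] by (simp add: Compl_eq_Diff_UNIV[symmetric] Collect_neg_eq)
    have "1 - y < measure_pmf.prob Q {k. real k \<in> - A}"
      using y by (simp only: compl)
    from lower[OF this] show "\<forall>\<^sub>F n in sequentially. measure_pmf.prob (p n) {x. X n x \<in> A} < y"
      by (simp only: compl) simp
  qed (rule lower)
qed

theorem theorem1p4:
  fixes q :: "nat \<Rightarrow> real" and lam :: real
  assumes "\<And>n. q n \<in> {0..1}"
    and "0 \<le> lam"
    and "(\<lambda>n. real n * q n) \<longlonglongrightarrow> lam"
  shows "weak_conv_m
           (\<lambda>n. distr (measure_pmf (mallows_tree n (q n))) borel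
                  (\<lambda>T. real n - 1 - real (tree_height T)))
           (distr (measure_pmf (poisson0_pmf lam)) borel real)"
proof -
  let ?X = "\<lambda>n T. real n - 1 - real (tree_height T)"
  let ?a = "\<lambda>n k. real ((n - (k + 1)) choose k) * q n ^ k * (1 - q n) ^ n"
  have "(\<lambda>n. real n * q n * inverse (real n)) \<longlonglongrightarrow> lam * 0"
    by (intro tendsto_mult assms lim_inverse_n)
  moreover have "\<forall>\<^sub>F n in sequentially. real n * q n * inverse (real n) = q n"
    using eventually_gt_at_top[of 0] by eventually_elim simp
  ultimately have q0: "q \<longlonglongrightarrow> 0"
    using Lim_transform_eventually by fastforce
  have lim: "(\<lambda>n. ?a n k) \<longlonglongrightarrow> pmf (poisson0_pmf lam) k" for k
    unfolding pmf_poisson0[OF assms(2)]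
    using assms(1) by (intro tendsto_mult tendsto_binomial_power tendsto_one_minus_power assms q0) auto
  have ge: "\<forall>\<^sub>F n in sequentially. ?a n k \<le>
      measure_pmf.prob (mallows_tree n (q n)) {T. ?X n T = real k}" for k
    using order_tendstoD(2)[OF q0 zero_less_one] eventually_ge_at_top[of 2]
  proof eventually_elim
    case (elim n)
    then obtain m where n: "n = m + 2" by (metis add.commute le_Suc_ex)
    show ?case
      using prob_height_deficit_ge[of "q n" m k] assms(1)[of n] elim by (simp add: n)
  qed
  have "(\<lambda>n. measure_pmf.prob (mallows_tree n (q n)) {T. ?X n T \<in> {..x}})
      \<longlonglongrightarrow> measure_pmf.prob (poisson0_pmf lam) {k. real k \<in> {..x}}" for x
    by (rule tendsto_prob_of_point_masses_ge[OF ge lim])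
  then show ?thesis
    by (simp add: weak_conv_m_def weak_conv_def cdf_def measure_distr vimage_def)
qed

end
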